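(* There exist an irrational rotation $Tx=x+\alpha$ on $\mathbb{T}$ and a continuous function $\varphi:\mathbb{T}\to\mathbb{R}$ such that the cylindrical transformation $T_\varphi(x,t)=(x+\alpha,t+\varphi(x))$ on $\mathbb{T}\times\mathbb{R}$ is Besicovitch and the Fourier coefficients of $\varphi$ satisfy $\widehat{\varphi}(n)=\mathrm{O}(\log|n|/|n|)$ as $|n|\to\infty$.
   Context: $\mathbb{T}=\mathbb{R}/\mathbb{Z}$; $\widehat{\varphi}(n)=\int_0^1\varphi(x)e^{-2\pi i n x}\,dx$. For $n\in\mathbb{Z}$: $\varphi^{(n)}(x)=\sum_{k=0}^{n-1}\varphi(x+k\alpha)$ for $n>0$, $\varphi^{(0)}=0$, $\varphi^{(n)}(x)=-\sum_{k=1}^{|n|}\varphi(x-k\alpha)$ for $n<0$. The orbit of $(x,t)$ under $T_\varphi$ is called discrete if $|\varphi^{(n)}(x)|\to+\infty$ as $|n|\to+\infty$. $T_\varphi$ is called Besicovitch if it has both a dense (two-sided) orbit and a discrete orbit. *)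

theory Defs
  imports "HOL-Analysis.Analysis" "HOL-Library.Landau_Symbols"
begin

quotient_type circle = real / "\<lambda>x y. x - y \<in> \<int>"
proof (rule equivpI)
  show "reflp (\<lambda>x y::real. x - y \<in> \<int>)"
    by (rule reflpI) simp
  show "symp (\<lambda>x y::real. x - y \<in> \<int>)"
    by (rule sympI) (metis Ints_minus minus_diff_eq)
  show "transp (\<lambda>x y::real. x - y \<in> \<int>)"
    by (rule transpI) (metis Ints_add add_diff_eq diff_add_cancel)
qed

lift_definition to_circle :: "real \<Rightarrow> circle" is "\<lambda>x. x" .

lemma to_circle_eq_iff: "to_circle x = to_circle y \<longleftrightarrow> x - y \<in> \<int>"
  by transfer simp

lemma surj_to_circle: "surj to_circle"
proof (rule surjI)
  show "to_circle (rep_circle z) = z" for z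
    by (simp add: to_circle_def Quotient3_abs_rep[OF Quotient3_circle])
qed

instantiation circle :: ab_group_add
begin

lift_definition zero_circle :: circle is 0 .

lift_definition plus_circle :: "circle \<Rightarrow> circle \<Rightarrow> circle" is "(+)"
  by (metis Ints_add add_diff_add)

lift_definition uminus_circle :: "circle \<Rightarrow> circle" is uminus
  by (metis Ints_minus minus_diff_minus)

lift_definition minus_circle :: "circle \<Rightarrow> circle \<Rightarrow> circle" is "(-)"
  by (metis Ints_diff diff_diff_eq2 diff_diff_eq diff_add_eq add.commute)

instance
  by standard (transfer; simp)+

end

lemma to_circle_0: "to_circle 0 = 0"
  by transfer simp

lemma to_circle_add: "to_circle (x + y) = to_circle x + to_circle y"
  by transfer simp

lemma to_circle_minus: "to_circle (- x) = - to_circle x"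
  by transfer simp

lemma to_circle_diff: "to_circle (x - y) = to_circle x - to_circle y"
  by transfer simp

instantiation circle :: topological_space
begin

definition open_circle :: "circle set \<Rightarrow> bool"
  where "open_circle U \<longleftrightarrow> open (to_circle -` U)"

instance
  by standard (auto simp: open_circle_def vimage_Union intro!: open_UN)

end

text \<open>
  The rotation angle is given by a real representative \<open>\<alpha>\<close>, so that \<open>k\<alpha>\<close> makes sense;
  everything below depends only on \<open>\<alpha>\<close> modulo 1.
\<close>

definition cylindrical :: "real \<Rightarrow> (circle \<Rightarrow> real) \<Rightarrow> circle \<times> real \<Rightarrow> circle \<times> real"
  where "cylindrical \<alpha> \<phi> = (\<lambda>(x, t). (x + to_circle \<alpha>, t + \<phi> x))"

definition birkhoff_sum :: "real \<Rightarrow> (circle \<Rightarrow> real) \<Rightarrow> int \<Rightarrow> circle \<Rightarrow> real"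
  where "birkhoff_sum \<alpha> \<phi> n x =
    (if n \<ge> 0 then (\<Sum>k<nat n. \<phi> (x + to_circle (real k * \<alpha>)))
     else - (\<Sum>k=1..nat \<bar>n\<bar>. \<phi> (x - to_circle (real k * \<alpha>))))"

text \<open>Two-sided orbit; intended for bijective \<open>T\<close>.\<close>

definition two_sided_orbit :: "('a \<Rightarrow> 'a) \<Rightarrow> 'a \<Rightarrow> 'a set"
  where "two_sided_orbit T p = range (\<lambda>n. (T ^^ n) p) \<union> range (\<lambda>n. (inv T ^^ n) p)"

abbreviation int_at_infinity :: "int filter"
  where "int_at_infinity \<equiv> filtercomap abs at_top"

definition discrete_orbit :: "real \<Rightarrow> (circle \<Rightarrow> real) \<Rightarrow> circle \<times> real \<Rightarrow> bool"
  where "discrete_orbit \<alpha> \<phi> p \<longleftrightarrow>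
    filterlim (\<lambda>n. \<bar>birkhoff_sum \<alpha> \<phi> n (fst p)\<bar>) at_top int_at_infinity"

definition besicovitch :: "real \<Rightarrow> (circle \<Rightarrow> real) \<Rightarrow> bool"
  where "besicovitch \<alpha> \<phi> \<longleftrightarrow>
    (\<exists>p. closure (two_sided_orbit (cylindrical \<alpha> \<phi>) p) = UNIV) \<and>
    (\<exists>p. discrete_orbit \<alpha> \<phi> p)"

definition fourier_coeff :: "(circle \<Rightarrow> real) \<Rightarrow> int \<Rightarrow> complex"
  where "fourier_coeff \<phi> n =
    integral {0..1} (\<lambda>x. complex_of_real (\<phi> (to_circle x)) *
      exp (- 2 * complex_of_real pi * \<i> * of_int n * complex_of_real x))"

lemma bij_cylindrical: "bij (cylindrical \<alpha> \<phi>)"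
  by (rule o_bij[where g = "\<lambda>(x, t). (x - to_circle \<alpha>, t - \<phi> (x - to_circle \<alpha>))"])
     (auto simp: cylindrical_def fun_eq_iff)

lemma inv_cylindrical:
  "inv (cylindrical \<alpha> \<phi>) = (\<lambda>(x, t). (x - to_circle \<alpha>, t - \<phi> (x - to_circle \<alpha>)))"
  by (rule inv_unique_comp) (auto simp: cylindrical_def fun_eq_iff)

lemma cylindrical_funpow:
  "(cylindrical \<alpha> \<phi> ^^ n) (x, t) =
     (x + to_circle (real n * \<alpha>), t + birkhoff_sum \<alpha> \<phi> (int n) x)"
proof (induction n)
  case 0
  show ?case by (simp add: birkhoff_sum_def to_circle_0)
next
  case (Suc n)
  then show ?case
    by (simp add: cylindrical_def birkhoff_sum_def nat_add_distrib ring_distribs to_circle_add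
        add_ac del: of_nat_Suc add: of_nat_Suc[where 'a = real])
qed

lemma inv_cylindrical_funpow:
  "(inv (cylindrical \<alpha> \<phi>) ^^ n) (x, t) =
     (x - to_circle (real n * \<alpha>), t + birkhoff_sum \<alpha> \<phi> (- int n) x)"
proof (induction n)
  case 0
  show ?case by (simp add: birkhoff_sum_def to_circle_0)
next
  case (Suc n)
  have step: "birkhoff_sum \<alpha> \<phi> (- int (Suc n)) x =
      birkhoff_sum \<alpha> \<phi> (- int n) x - \<phi> (x - to_circle (real (Suc n) * \<alpha>))"
    by (cases "n = 0") (auto simp: birkhoff_sum_def nat_add_distrib)
  have shift: "x - to_circle (real n * \<alpha>) - to_circle \<alpha> = x - to_circle (real (Suc n) * \<alpha>)"
    by (simp add: ring_distribs to_circle_add algebra_simps)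
  have "(inv (cylindrical \<alpha> \<phi>) ^^ Suc n) (x, t) =
      inv (cylindrical \<alpha> \<phi>) (x - to_circle (real n * \<alpha>), t + birkhoff_sum \<alpha> \<phi> (- int n) x)"
    using Suc by simp
  also have "\<dots> = (x - to_circle (real (Suc n) * \<alpha>), t + birkhoff_sum \<alpha> \<phi> (- int (Suc n)) x)"
    unfolding inv_cylindrical prod.case shift step by simp
  finally show ?case .
qed

lemma two_sided_orbit_cylindrical:
  "two_sided_orbit (cylindrical \<alpha> \<phi>) (x, t) =
     range (\<lambda>n::int. (x + to_circle (of_int n * \<alpha>), t + birkhoff_sum \<alpha> \<phi> n x))"
    (is "_ = range ?f")
proof -
  have "two_sided_orbit (cylindrical \<alpha> \<phi>) (x, t) =
      range (\<lambda>n. ?f (int n)) \<union> range (\<lambda>n. ?f (- int n))"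
    by (simp add: two_sided_orbit_def cylindrical_funpow inv_cylindrical_funpow to_circle_minus)
  also have "\<dots> = ?f ` (range int \<union> range (\<lambda>n. - int n))"
    by (auto simp: image_Un image_image)
  also have "range int \<union> range (\<lambda>n. - int n) = UNIV"
    by (auto intro: int_cases2)
  finally show ?thesis .
qed

end

(*
  For any irrational alpha take phi = sum_k (z_k - z_k o T) with z_k supported near finitely many
  points of the orbits of 0 and 1/2, so that phi^(n)(x) = sum_k (z_k(x) - z_k(x + n alpha)).
  Along the orbit of 0, z_k decreases from its maximum z_k(0) = 4^k to 0 over 8^k steps
  in both time directions; hence all terms are nonnegative at x = 0, and the k-th one is at
  least 4^k / 2 for 8^k <= |n| <= 8^(k+1). Along the orbit of 1/2, z_k has a second hump, centred at
  a time N_k and of height beta_k, where beta_k is tuned so that phi^(N_k)(1/2) is the k-th term r_k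
  of a prescribed sequence; this makes the orbit of (1/2, 0) dense. Going down in 8^k steps makes
  z_k - z_k o T uniformly small. The spatial width delta of the bumps carrying z_k remains free. Their
  Fourier coefficients are O(1/|n|) uniformly in delta and tend to 0 with delta uniformly in n, so a
  small delta forces a bound omega ln|n| / |n| for z_k with omega as small as desired.
*)
theory Submission
  imports Defs
begin

section \<open>The circle\<close>

text \<open>Universal property of the quotient topology; it reduces continuity on the circle to
  continuity on the real line.\<close>

lemma continuous_on_circle_iff:
  fixes g :: "circle \<Rightarrow> 'a::topological_space"
  shows "continuous_on UNIV g \<longleftrightarrow> continuous_on UNIV (\<lambda>x. g (to_circle x))"
  by (simp add: continuous_on_open_vimage open_circle_def vimage_def)

lemma continuous_on_circle_shift:
  fixes g :: "circle \<Rightarrow> 'a::topological_space"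
  assumes "continuous_on UNIV g"
  shows "continuous_on UNIV (\<lambda>x. g (x + c))"
proof -
  obtain d where c: "c = to_circle d"
    using surj_to_circle by (metis surjD)
  have "continuous_on UNIV (\<lambda>x. g (to_circle (x + d)))"
    using assms unfolding continuous_on_circle_iff
    by (rule continuous_on_compose2) (auto intro!: continuous_intros)
  then show ?thesis
    by (simp add: continuous_on_circle_iff to_circle_add c)
qed

lemma continuous_on_circle_shift_diff:
  fixes g :: "circle \<Rightarrow> 'a::topological_space"
  assumes "continuous_on UNIV g"
  shows "continuous_on UNIV (\<lambda>x. g (x - c))"
  using continuous_on_circle_shift[OF assms, of "- c"] by simp

lemma to_circle_of_int: "to_circle (of_int n) = 0"
  by (simp flip: to_circle_0 add: to_circle_eq_iff)

text \<open>Both lifts are irrational, hence not integers. Together with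
  \<open>to_circle_half\<close> this makes the rotation orbits of 0 and 1/2 infinite and
  disjoint.\<close>

lemma to_circle_of_int_mult:
  assumes "x \<notin> \<rat>" "n \<noteq> 0"
  shows "to_circle (of_int n * x) \<noteq> 0" "to_circle (1/2 + of_int n * x) \<noteq> 0"
proof -
  have "of_int n * x \<notin> \<rat>"
  proof
    assume "of_int n * x \<in> \<rat>"
    then have "of_int n * x / of_int n \<in> \<rat>" by (intro Rats_divide) auto
    with assms show False by simp
  qed
  moreover have "1/2 + of_int n * x \<notin> \<rat>"
  proof
    assume "1/2 + of_int n * x \<in> \<rat>"
    then have "1/2 + of_int n * x - 1/2 \<in> \<rat>" by (intro Rats_diff) auto
    then show False using \<open>of_int n * x \<notin> \<rat>\<close> by simp
  qed
  ultimately show "to_circle (of_int n * x) \<noteq> 0" "to_circle (1/2 + of_int n * x) \<noteq> 0"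
    using Ints_subset_Rats by (auto simp flip: to_circle_0 simp: to_circle_eq_iff)
qed

lemma to_circle_half: "to_circle (1/2) \<noteq> 0"
proof
  assume "to_circle (1/2) = 0"
  then obtain k :: int where "1/2 = real_of_int k"
    by (auto simp flip: to_circle_0 simp: to_circle_eq_iff elim: Ints_cases)
  then have "real_of_int (2 * k) = real_of_int 1" by simp
  then have "2 * k = 1" by (simp only: of_int_eq_iff)
  then show False by presburger
qed

section \<open>Fourier coefficients\<close>

lemma fourier_integrand_continuous:
  assumes "continuous_on UNIV g"
  shows "continuous_on S (\<lambda>x. complex_of_real (g (to_circle x)) *
      exp (- 2 * complex_of_real pi * \<i> * of_int n * complex_of_real x))"
  using assms unfolding continuous_on_circle_iff
  by (auto intro!: continuous_intros elim: continuous_on_subset)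

lemma fourier_integrand_integrable:
  assumes "continuous_on UNIV g"
  shows "(\<lambda>x. complex_of_real (g (to_circle x)) *
      exp (- 2 * complex_of_real pi * \<i> * of_int n * complex_of_real x)) integrable_on {a..b}"
  by (intro integrable_continuous_interval fourier_integrand_continuous assms)

lemma fourier_coeff_add:
  assumes "continuous_on UNIV g" "continuous_on UNIV h"
  shows "fourier_coeff (\<lambda>x. g x + h x) n = fourier_coeff g n + fourier_coeff h n"
  using Henstock_Kurzweil_Integration.integral_add[OF assms[THEN fourier_integrand_integrable, of n 0 1]]
  by (simp add: fourier_coeff_def distrib_right)

lemma fourier_coeff_diff:
  assumes "continuous_on UNIV g" "continuous_on UNIV h"
  shows "fourier_coeff (\<lambda>x. g x - h x) n = fourier_coeff g n - fourier_coeff h n"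
  using Henstock_Kurzweil_Integration.integral_diff[OF assms[THEN fourier_integrand_integrable, of n 0 1]]
  by (simp add: fourier_coeff_def left_diff_distrib)

lemma fourier_coeff_cmult: "fourier_coeff (\<lambda>x. c * g x) n = of_real c * fourier_coeff g n"
  by (simp add: fourier_coeff_def mult.assoc)

lemma fourier_coeff_sum:
  assumes "finite S" "\<And>i. i \<in> S \<Longrightarrow> continuous_on UNIV (g i)"
  shows "fourier_coeff (\<lambda>x. \<Sum>i\<in>S. g i x) n = (\<Sum>i\<in>S. fourier_coeff (g i) n)"
  using assms
proof (induction S rule: finite_induct)
  case empty
  show ?case by (simp add: fourier_coeff_def)
next
  case (insert i S)
  then show ?case
    by (simp add: fourier_coeff_add continuous_on_sum)
qed

lemma norm_fourier_coeff_le: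
  assumes "continuous_on UNIV g" "\<And>x. \<bar>g x\<bar> \<le> B"
  shows "norm (fourier_coeff g n) \<le> B"
proof -
  have "norm (fourier_coeff g n) \<le> B * (1 - 0)"
    unfolding fourier_coeff_def
    by (intro integral_bound fourier_integrand_continuous assms)
       (auto simp: norm_mult assms norm_exp_eq_Re)
  then show ?thesis by simp
qed

text \<open>The window [c, 1 + c] is cut at 1, and the overhang [1, 1 + c] is moved back to [0, c]
  by the period.\<close>

lemma integral_periodic_shift:
  fixes F :: "real \<Rightarrow> complex"
  assumes F: "continuous_on UNIV F" and per: "\<And>x. F (x + 1) = F x" and c: "0 \<le> c" "c \<le> 1"
  shows "integral {0..1} (\<lambda>x. F (x + c)) = integral {0..1} F"
proof -
  have int: "F integrable_on {a..b}" for a b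
    using F by (intro integrable_continuous_interval) (rule continuous_on_subset, auto)
  have shift: "integral {a..b} (\<lambda>x. F (x + c)) = integral {a+c..b+c} F" if "a \<le> b" for a b c
    using has_integral_affinity[OF integrable_integral[OF int[of "a + c" "b + c", folded box_real(2)]], of 1 c] that
    by (simp add: integral_unique)
  have "integral {0..1} (\<lambda>x. F (x + c)) = integral {c..1+c} F"
    using shift[of 0 1] by simp
  also have "\<dots> = integral {c..1} F + integral {1..1+c} F"
    using c by (intro Henstock_Kurzweil_Integration.integral_combine[symmetric] int) auto
  also have "integral {1..1+c} F = integral {0..c} F"
    using shift[of 0 c 1] c by (simp add: per add.commute)
  also have "integral {c..1} F + integral {0..c} F = integral {0..1} F"
    using c by (subst add.commute, intro Henstock_Kurzweil_Integration.integral_combine int) auto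
  finally show ?thesis .
qed

text \<open>Translation multiplies the coefficient by a number of modulus 1. Every translated bump
  therefore has the same Fourier bound.\<close>

lemma norm_fourier_coeff_shift:
  assumes "continuous_on UNIV g"
  shows "norm (fourier_coeff (\<lambda>x. g (x + c)) n) = norm (fourier_coeff g n)"
proof -
  obtain d0 where c0: "c = to_circle d0"
    using surj_to_circle by (metis surjD)
  \<comment> \<open>A representative in [0, 1), as \<open>integral_periodic_shift\<close>
    requires.\<close>
  define d where "d = frac d0"
  have c: "c = to_circle d"
    by (simp add: c0 d_def to_circle_eq_iff frac_def)
  have d: "0 \<le> d" "d \<le> 1"
    by (auto simp: d_def frac_ge_0 less_imp_le[OF frac_lt_1])
  define F where "F = (\<lambda>x. complex_of_real (g (to_circle x)) *
      exp (- 2 * complex_of_real pi * \<i> * of_int n * complex_of_real x))"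
  have per: "F (x + 1) = F x" for x
  proof -
    have "exp (- 2 * complex_of_real pi * \<i> * of_int n * complex_of_real (x + 1)) =
       exp (- 2 * complex_of_real pi * \<i> * of_int n * complex_of_real x) *
       exp (2 * complex_of_real pi * \<i> * of_int (- n))"
      by (simp add: exp_add[symmetric] algebra_simps)
    also have "exp (2 * complex_of_real pi * \<i> * of_int (- n)) = 1"
      using exp_integer_2pi[of "of_int (- n)"] by (simp add: mult_ac)
    moreover have "to_circle (x + 1) = to_circle x"
      by (simp add: to_circle_eq_iff)
    ultimately show ?thesis by (simp add: F_def)
  qed
  have "fourier_coeff (\<lambda>x. g (x + c)) n =
      integral {0..1} (\<lambda>x. exp (2 * complex_of_real pi * \<i> * of_int n * complex_of_real d) * F (x + d))"
    unfolding fourier_coeff_def F_def c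
    by (intro arg_cong[where f = "integral {0..1}"] ext)
       (simp add: to_circle_add algebra_simps flip: exp_add)
  also have "\<dots> = exp (2 * complex_of_real pi * \<i> * of_int n * complex_of_real d) *
      integral {0..1} (\<lambda>x. F (x + d))"
    by simp
  also have "integral {0..1} (\<lambda>x. F (x + d)) = integral {0..1} F"
    using fourier_integrand_continuous[OF assms, of UNIV n] d
    by (intro integral_periodic_shift per) (simp_all add: F_def)
  also have "integral {0..1} F = fourier_coeff g n"
    by (simp add: F_def fourier_coeff_def)
  finally show ?thesis
    by (simp add: norm_mult norm_exp_eq_Re)
qed

text \<open>The second mean value theorem replaces the monotone factor by its two end values, which
  leaves integrals of sine and cosine of size at most 2 / |n|. The steepness of \<open>g\<close>
  does not enter, so the bound will be uniform in the bump width.\<close>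

lemma norm_integral_mono_mult_exp_le:
  fixes g :: "real \<Rightarrow> real"
  assumes ab: "a \<le> b" and g: "continuous_on {a..b} g"
    and mono: "\<And>x y. \<lbrakk>a \<le> x; x \<le> y; y \<le> b\<rbrakk> \<Longrightarrow> g x \<le> g y"
    and bound: "\<bar>g a\<bar> \<le> 1" "\<bar>g b\<bar> \<le> 1" and n: "n \<noteq> 0"
  shows "norm (integral {a..b} (\<lambda>x. complex_of_real (g x) *
      exp (- 2 * complex_of_real pi * \<i> * of_int n * complex_of_real x))) \<le> 8 / \<bar>of_int n\<bar>"
proof -
  define w where "w = 2 * pi * real_of_int n"
  have w: "\<bar>w\<bar> \<ge> \<bar>of_int n\<bar>" "w \<noteq> 0"
  proof -
    have "2 * pi \<ge> 1" using pi_ge_two by simp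
    then show "\<bar>w\<bar> \<ge> \<bar>of_int n\<bar>"
      unfolding w_def abs_mult by (simp add: mult_le_cancel_right1)
    show "w \<noteq> 0" using n by (simp add: w_def)
  qed
  \<comment> \<open>Stated for any \<open>f\<close> with a bounded primitive \<open>h / w\<close>,
    so as to serve both the real part (\<open>h\<close> a sine) and the imaginary part
    (\<open>h\<close> a cosine).\<close>
  have osc: "\<bar>integral {a..b} (\<lambda>x. g x * f x)\<bar> \<le> 4 / \<bar>of_int n\<bar>"
    if f: "continuous_on UNIV f" and der: "\<And>x. (h has_real_derivative w * f x) (at x)"
      and h: "\<And>x. \<bar>h x\<bar> \<le> 1" for f h :: "real \<Rightarrow> real"
  proof -
    have I: "\<bar>integral {s..t} f\<bar> \<le> 2 / \<bar>of_int n\<bar>" if "s \<le> t" for s t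
    proof -
      have "((\<lambda>x. h x / w) has_vector_derivative f x) (at x within {s..t})" for x
        using DERIV_cdivide[OF der, of w x] w(2)
        by (simp add: has_real_derivative_iff_has_vector_derivative has_vector_derivative_at_within)
      then have "(f has_integral (h t / w - h s / w)) {s..t}"
        by (intro fundamental_theorem_of_calculus that)
      then have "integral {s..t} f = (h t - h s) / w"
        by (simp add: integral_unique diff_divide_distrib)
      also have "\<bar>\<dots>\<bar> \<le> 2 / \<bar>w\<bar>"
        using h[of s] h[of t] unfolding abs_divide by (intro divide_right_mono) auto
      also have "\<dots> \<le> 2 / \<bar>of_int n\<bar>"
        using w n by (intro divide_left_mono) (auto intro!: mult_pos_pos)
      finally show ?thesis .
    qed
    have "f integrable_on {a..b}"
      using f by (intro integrable_continuous_interval) (auto elim: continuous_on_subset)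
    from second_mean_value_theorem[OF this ab, of g, OF mono] obtain c where c: "c \<in> {a..b}"
      and eq: "integral {a..b} (\<lambda>x. g x * f x) = g a * integral {a..c} f + g b * integral {c..b} f"
      by blast
    have "\<bar>g a * integral {a..c} f\<bar> \<le> 1 * (2 / \<bar>of_int n\<bar>)"
      unfolding abs_mult using c by (intro mult_mono bound I) auto
    moreover have "\<bar>g b * integral {c..b} f\<bar> \<le> 1 * (2 / \<bar>of_int n\<bar>)"
      unfolding abs_mult using c by (intro mult_mono bound I) auto
    ultimately show ?thesis unfolding eq by linarith
  qed
  define G where "G = (\<lambda>x. complex_of_real (g x) *
      exp (- 2 * complex_of_real pi * \<i> * of_int n * complex_of_real x))"
  have G: "G integrable_on {a..b}"
    unfolding G_def by (intro integrable_continuous_interval continuous_intros g)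
  have ReG: "Re (G x) = g x * cos (w * x)" and ImG: "Im (G x) = g x * - sin (w * x)" for x
    by (simp_all add: G_def Re_exp Im_exp w_def mult_ac)
  have "Re (integral {a..b} G) = integral {a..b} (\<lambda>x. g x * cos (w * x))"
    using integral_linear[OF G bounded_linear_Re] by (simp add: o_def ReG)
  also have "\<bar>\<dots>\<bar> \<le> 4 / \<bar>of_int n\<bar>"
    by (rule osc[of _ "\<lambda>x. sin (w * x)"]) (auto intro!: continuous_intros derivative_eq_intros)
  finally have 1: "\<bar>Re (integral {a..b} G)\<bar> \<le> 4 / \<bar>of_int n\<bar>" .
  have "Im (integral {a..b} G) = integral {a..b} (\<lambda>x. g x * - sin (w * x))"
    using integral_linear[OF G bounded_linear_Im] by (simp add: o_def ImG)
  also have "\<bar>\<dots>\<bar> \<le> 4 / \<bar>of_int n\<bar>"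
    by (rule osc[of _ "\<lambda>x. cos (w * x)"]) (auto intro!: continuous_intros derivative_eq_intros)
  finally have 2: "\<bar>Im (integral {a..b} G)\<bar> \<le> 4 / \<bar>of_int n\<bar>" .
  have "norm (integral {a..b} G) \<le> 8 / \<bar>of_int n\<bar>"
    using cmod_le[of "integral {a..b} G"] 1 2 by simp
  then show ?thesis by (simp add: G_def)
qed

section \<open>Bumps\<close>

text \<open>Half the chord |exp(2 pi i x) - 1|: a subadditive distance to 0 that is given by a
  single continuous formula, monotone on each half period.\<close>

lift_definition circle_dist :: "circle \<Rightarrow> real" is "\<lambda>x. \<bar>sin (pi * x)\<bar>"
proof -
  fix x y :: real
  assume "x - y \<in> \<int>"
  then obtain k where "x - y = of_int k"
    by (auto elim: Ints_cases)
  then have "x = y + of_int k"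
    by simp
  then have "pi * x = pi * y + pi * of_int k"
    by (simp add: distrib_left)
  then show "\<bar>sin (pi * x)\<bar> = \<bar>sin (pi * y)\<bar>"
    by (simp add: sin_add abs_mult)
qed

lemma circle_dist_to_circle: "circle_dist (to_circle x) = \<bar>sin (pi * x)\<bar>"
  by transfer simp

lemma circle_dist_nonneg [simp]: "circle_dist x \<ge> 0"
  by transfer simp

lemma circle_dist_eq_0_iff [simp]: "circle_dist x = 0 \<longleftrightarrow> x = 0"
proof transfer
  fix x :: real
  have "sin (pi * x) = 0 \<longleftrightarrow> (\<exists>i. x = real_of_int i)"
    by (auto simp: sin_zero_iff_int2 mult.commute[of pi])
  then show "\<bar>sin (pi * x)\<bar> = 0 \<longleftrightarrow> x - 0 \<in> \<int>"
    by (auto elim: Ints_cases)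
qed

lemma circle_dist_0 [simp]: "circle_dist 0 = 0"
  by simp

lemma circle_dist_diff_le: "circle_dist (x - y) \<le> circle_dist x + circle_dist y"
proof transfer
  fix x y :: real
  have "\<bar>sin (pi * (x - y))\<bar> \<le> \<bar>sin (pi * x)\<bar> * \<bar>cos (pi * y)\<bar> + \<bar>cos (pi * x)\<bar> * \<bar>sin (pi * y)\<bar>"
    using abs_triangle_ineq4[of "sin (pi * x) * cos (pi * y)"]
    by (simp add: right_diff_distrib sin_diff flip: abs_mult)
  also have "\<dots> \<le> \<bar>sin (pi * x)\<bar> * 1 + 1 * \<bar>sin (pi * y)\<bar>"
    by (intro add_mono mult_mono) auto
  finally show "\<bar>sin (pi * (x - y))\<bar> \<le> \<bar>sin (pi * x)\<bar> + \<bar>sin (pi * y)\<bar>"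
    by simp
qed

definition bump :: "real \<Rightarrow> circle \<Rightarrow> real"
  where "bump \<delta> x = max 0 (1 - circle_dist x / \<delta>)"

lemma bump_nonneg [simp]: "0 \<le> bump \<delta> x"
  by (simp add: bump_def)

lemma bump_le_1: "\<delta> > 0 \<Longrightarrow> bump \<delta> x \<le> 1"
  by (simp add: bump_def)

lemma bump_0 [simp]: "bump \<delta> 0 = 1"
  by (simp add: bump_def)

lemma bump_eq_0: "\<delta> > 0 \<Longrightarrow> circle_dist x \<ge> \<delta> \<Longrightarrow> bump \<delta> x = 0"
  by (simp add: bump_def)

text \<open>If both bumps were nonzero, \<open>x\<close> and \<open>y\<close> would be closer than
  \<delta> to 0, and the triangle inequality would bring them closer than 2\<delta> to each
  other.\<close>

lemma bump_disjoint:
  assumes "\<delta> > 0" "2 * \<delta> \<le> circle_dist (x - y)"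
  shows "bump \<delta> x = 0 \<or> bump \<delta> y = 0"
  using circle_dist_diff_le[of x y] assms bump_eq_0[of \<delta> x] bump_eq_0[of \<delta> y] by linarith

lemma bump_to_circle: "bump \<delta> (to_circle x) = max 0 (1 - \<bar>sin (pi * x)\<bar> / \<delta>)"
  by (simp add: bump_def circle_dist_to_circle)

lemma continuous_bump: "\<delta> > 0 \<Longrightarrow> continuous_on UNIV (bump \<delta>)"
  by (auto simp: continuous_on_circle_iff bump_to_circle intro!: continuous_intros)

text \<open>A bump is monotone on each of [0, 1/2] and [1/2, 1], so each half contributes at most 8
  / |n|, whatever the width.\<close>

lemma norm_fourier_bump_le:
  assumes \<delta>: "\<delta> > 0" and n: "n \<noteq> 0"
  shows "norm (fourier_coeff (bump \<delta>) n) \<le> 16 / \<bar>of_int n\<bar>"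
proof -
  define g where "g = (\<lambda>x. bump \<delta> (to_circle x))"
  define F where "F = (\<lambda>h (x::real). complex_of_real (h x) *
      exp (- 2 * complex_of_real pi * \<i> * of_int n * complex_of_real x))"
  have g: "continuous_on S g" for S
    using continuous_bump[OF \<delta>] unfolding continuous_on_circle_iff g_def
    by (auto elim: continuous_on_subset)
  have g1: "\<bar>g x\<bar> \<le> 1" for x
    using bump_le_1[OF \<delta>] by (simp add: g_def)
  have sin_mono: "g y \<le> g x" if "0 \<le> sin (pi * x)" "sin (pi * x) \<le> sin (pi * y)" for x y
  proof -
    have "1 - sin (pi * y) / \<delta> \<le> 1 - sin (pi * x) / \<delta>"
      using that \<delta> by (simp add: divide_right_mono)
    then show ?thesis
      using that by (simp add: g_def bump_to_circle max.coboundedI2)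
  qed
  \<comment> \<open>The bump decreases here; the sign change makes it increasing, as the oscillation
    lemma demands.\<close>
  have "norm (integral {0..1/2} (F (\<lambda>x. - g x))) \<le> 8 / \<bar>of_int n\<bar>"
    unfolding F_def
  proof (rule norm_integral_mono_mult_exp_le)
    fix x y :: real assume xy: "0 \<le> x" "x \<le> y" "y \<le> 1/2"
    have "sin (pi * x) \<le> sin (pi * y)"
      using xy by (intro sin_monotone_2pi_le) (auto intro: order_trans[of _ 0])
    moreover have "0 \<le> sin (pi * x)"
      using xy by (intro sin_ge_zero) auto
    ultimately show "- g x \<le> - g y"
      using sin_mono[of x y] by simp
  qed (use n g1 in \<open>auto intro!: continuous_intros g\<close>)
  moreover have "norm (integral {1/2..1} (F g)) \<le> 8 / \<bar>of_int n\<bar>"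
    unfolding F_def
  proof (rule norm_integral_mono_mult_exp_le)
    fix x y :: real assume xy: "1/2 \<le> x" "x \<le> y" "y \<le> 1"
    have "sin (pi - pi * y) \<le> sin (pi - pi * x)"
      using xy mult_left_mono[of "1/2" x pi] mult_left_mono[of y 1 pi]
      by (intro sin_monotone_2pi_le) (auto intro: order_trans[of _ 0])
    moreover have "0 \<le> sin (pi * y)"
      using xy by (intro sin_ge_zero) auto
    ultimately show "g x \<le> g y"
      using sin_mono[of y x] by simp
  qed (use n g1 in \<open>auto intro!: continuous_intros g\<close>)
  moreover have "fourier_coeff (bump \<delta>) n = integral {0..1/2} (F g) + integral {1/2..1} (F g)"
    unfolding fourier_coeff_def F_def g_def
    by (rule Henstock_Kurzweil_Integration.integral_combine[symmetric])
       (simp, simp, intro fourier_integrand_integrable continuous_bump \<delta>)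
  moreover have "integral {0..1/2} (F (\<lambda>x. - g x)) = - integral {0..1/2} (F g)"
    by (simp add: F_def)
  ultimately show ?thesis
    using norm_triangle_ineq[of "integral {0..1/2} (F g)" "integral {1/2..1} (F g)"] by simp
qed

text \<open>The trivial bound by the length of the support: it is uniform in \<open>n\<close> and
  handles the finitely many frequencies for which the decay 16 / |n| is too weak.\<close>

lemma fourier_bump_small:
  assumes "\<eta> > 0"
  obtains \<delta>0 where "\<delta>0 > 0"
    "\<And>\<delta> n. \<lbrakk>0 < \<delta>; \<delta> \<le> \<delta>0\<rbrakk> \<Longrightarrow> norm (fourier_coeff (bump \<delta>) n) \<le> \<eta>"
proof
  \<comment> \<open>The bump will live on [0, s] and [1 - s, 1], of total length at most \<eta>; the
    cap keeps \<open>pi * s\<close> where sine increases. The witness for \<open>\<delta>0\<close>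
    is \<open>sin (pi * s)\<close>.\<close>
  define s where "s = min (1/4) (\<eta>/2)"
  have s: "0 < s" "s \<le> 1/4" "2 * s \<le> \<eta>"
    using assms by (auto simp: s_def)
  show "sin (pi * s) > 0"
    using s by (intro sin_gt_zero) auto
  fix \<delta> :: real and n :: int
  assume \<delta>: "0 < \<delta>" "\<delta> \<le> sin (pi * s)"
  define F where "F = (\<lambda>x. complex_of_real (bump \<delta> (to_circle x)) *
      exp (- 2 * complex_of_real pi * \<i> * of_int n * complex_of_real x))"
  have F: "continuous_on S F" for S
    unfolding F_def by (intro fourier_integrand_continuous continuous_bump \<delta>)
  have F1: "norm (F x) \<le> 1" for x
    using bump_le_1[OF \<delta>(1)] by (simp add: F_def norm_mult norm_exp_eq_Re)
  have F0: "F x = 0" if x: "s \<le> x" "x \<le> 1 - s" for x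
  proof -
    have "sin (pi * s) \<le> sin (pi * x)"
    proof (cases "x \<le> 1/2")
      case True
      then show ?thesis
        using x s by (intro sin_monotone_2pi_le) (auto intro: order_trans[of _ 0])
    next
      case False
      have "sin (pi * s) \<le> sin (pi * (1 - x))"
        using x s False by (intro sin_monotone_2pi_le) (auto intro: order_trans[of _ 0])
      then show ?thesis by (simp add: right_diff_distrib)
    qed
    then show ?thesis
      using \<delta> by (simp add: F_def bump_eq_0 circle_dist_to_circle)
  qed
  have int: "F integrable_on {a..b}" for a b
    by (intro integrable_continuous_interval F)
  have "integral {0..1} F = integral {0..s} F + integral {s..1} F"
    using s by (intro Henstock_Kurzweil_Integration.integral_combine[symmetric] int) auto
  also have "integral {s..1} F = integral {s..1-s} F + integral {1-s..1} F"
    using s by (intro Henstock_Kurzweil_Integration.integral_combine[symmetric] int) auto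
  also have "integral {s..1-s} F = integral {s..1-s} (\<lambda>_. 0)"
    using F0 by (intro integral_cong) auto
  finally have "integral {0..1} F = integral {0..s} F + integral {1-s..1} F"
    by simp
  moreover have "norm (integral {0..s} F) \<le> 1 * (s - 0)"
    using s by (intro integral_bound F F1) auto
  moreover have "norm (integral {1-s..1} F) \<le> 1 * (1 - (1 - s))"
    using s by (intro integral_bound F F1) auto
  ultimately have "norm (integral {0..1} F) \<le> \<eta>"
    using norm_triangle_ineq[of "integral {0..s} F" "integral {1-s..1} F"] s by simp
  then show "norm (fourier_coeff (bump \<delta>) n) \<le> \<eta>"
    by (simp add: fourier_coeff_def F_def)
qed

section \<open>Tower functions\<close>

lemma finite_pos_lower_bound:
  fixes f :: "'a \<Rightarrow> real"
  assumes "finite Q" "\<And>q. q \<in> Q \<Longrightarrow> f q > 0"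
  obtains \<delta> where "\<delta> > 0" "\<And>q. q \<in> Q \<Longrightarrow> \<delta> \<le> f q"
proof
  \<comment> \<open>The inserted 1 keeps the minimum meaningful for empty \<open>Q\<close>.\<close>
  show "Min (insert 1 (f ` Q)) > 0"
    using assms by (subst Min_gr_iff) auto
  show "Min (insert 1 (f ` Q)) \<le> f q" if "q \<in> Q" for q
    using assms that by (intro Min_le) auto
qed

definition tent :: "nat \<Rightarrow> int \<Rightarrow> real"
  where "tent L j = max 0 (1 - of_int \<bar>j\<bar> / of_nat L)"

lemma tent_nonneg [simp]: "0 \<le> tent L j"
  by (simp add: tent_def)

lemma tent_le_1: "tent L j \<le> 1"
  by (simp add: tent_def)

lemma tent_0 [simp]: "tent L 0 = 1"
  by (simp add: tent_def)

lemma tent_eq_0: "L > 0 \<Longrightarrow> \<bar>j\<bar> \<ge> int L \<Longrightarrow> tent L j = 0"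
  by (simp add: tent_def le_divide_eq)

lemma tent_lipschitz:
  assumes "L > 0"
  shows "\<bar>tent L (j + 1) - tent L j\<bar> \<le> 1 / of_nat L"
proof -
  have "\<bar>of_int \<bar>j + 1\<bar> - of_int \<bar>j\<bar> :: real\<bar> \<le> 1" by linarith
  then have "\<bar>(of_int \<bar>j + 1\<bar> - of_int \<bar>j\<bar> :: real) / of_nat L\<bar> \<le> 1 / of_nat L"
    unfolding abs_divide abs_of_nat by (rule divide_right_mono) simp
  then show ?thesis
    unfolding tent_def diff_divide_distrib by linarith
qed

text \<open>\<open>L\<close> is the number of steps of the descent along the orbit of 0,
  \<open>R\<close> the time horizon within which the orbits of 0 and 1/2 are controlled, and
  \<omega> the Fourier budget. \<open>disjoint\<close> allows a translate of \<open>E\<close> to be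
  added as a second hump without overlap.\<close>

locale tower =
  fixes \<alpha> \<omega> :: real and L R :: nat and E :: "circle \<Rightarrow> real"
  assumes continuous: "continuous_on UNIV E"
    and nonneg: "0 \<le> E x" and le_1: "E x \<le> 1" and at_0: "E 0 = 1"
    and step: "\<bar>E (x + to_circle \<alpha>) - E x\<bar> \<le> 1 / real L"
    and orbit_0: "\<lbrakk>int L \<le> \<bar>n\<bar>; \<bar>n\<bar> \<le> int R\<rbrakk> \<Longrightarrow> E (to_circle (of_int n * \<alpha>)) = 0"
    and orbit_half: "\<bar>n\<bar> \<le> int R \<Longrightarrow> E (to_circle (1/2 + of_int n * \<alpha>)) = 0"
    and disjoint: "\<bar>n\<bar> \<le> int R \<Longrightarrow> E x = 0 \<or> E (x - to_circle (1/2 + of_int n * \<alpha>)) = 0"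
    and fourier: "\<bar>n\<bar> \<ge> 2 \<Longrightarrow> norm (fourier_coeff E n) \<le> \<omega> * (ln \<bar>of_int n\<bar> / \<bar>of_int n\<bar>)"

text \<open>\<open>E\<close> is a sum of equal narrow bumps at the points
  \<open>j * \<alpha>\<close>, weighted by a tent in \<open>j\<close>. All geometric requirements
  say that finitely many nonzero points stay away from 0, so they hold for every small width; the
  Fourier bound needs one further restriction on the width.\<close>

lemma tower_exists:
  fixes \<alpha> \<omega> :: real and L R :: nat
  assumes \<alpha>: "\<alpha> \<notin> \<rat>" and L: "L > 0" and \<omega>: "\<omega> > 0"
  shows "\<exists>E. tower \<alpha> \<omega> L R E"
proof -
  define p where "p = (\<lambda>j::int. to_circle (of_int j * \<alpha>))"
  define h where "h = to_circle (1/2)"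
  have p_add: "p (i + j) = p i + p j" and p_diff: "p (i - j) = p i - p j" for i j
    by (simp_all add: p_def ring_distribs to_circle_add to_circle_diff)
  have p0 [simp]: "p 0 = 0" and p1: "p 1 = to_circle \<alpha>"
    by (simp_all add: p_def to_circle_0)
  have hp: "to_circle (1/2 + of_int j * \<alpha>) = h + p j" for j
    by (simp add: h_def p_def to_circle_add)
  \<comment> \<open>Two indices in {-L-1..L} differ by at most 2L + 1; \<open>R\<close> is added for
    the times \<open>n\<close> in the orbit conditions.\<close>
  define K where "K = int R + 2 * int L + 1"
  define Q where "Q = p ` ({-K..K} - {0}) \<union> (\<lambda>j. h + p j) ` {-K..K}"
  have pQ: "p j \<in> Q" if "j \<noteq> 0" "\<bar>j\<bar> \<le> K" for j
    unfolding Q_def using that by (intro UnI1 imageI) auto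
  have hQ: "h + p j \<in> Q" if "\<bar>j\<bar> \<le> K" for j
    unfolding Q_def using that by (intro UnI2 imageI) auto
  have Qpos: "circle_dist q > 0" if "q \<in> Q" for q
  proof -
    have "p j \<noteq> 0" "h + p j \<noteq> 0" if "j \<noteq> 0" for j
      using to_circle_of_int_mult[OF \<alpha> that] by (auto simp: p_def hp[unfolded p_def])
    moreover have "h \<noteq> 0" by (simp add: h_def to_circle_half)
    ultimately have "h + p j \<noteq> 0" "p j = 0 \<longleftrightarrow> j = 0" for j
      by (cases "j = 0"; simp)+
    then have "q \<noteq> 0" using that unfolding Q_def by auto
    then show ?thesis
      using circle_dist_nonneg[of q] by (simp add: less_le)
  qed
  obtain \<delta>1 where \<delta>1: "\<delta>1 > 0" "\<And>q. q \<in> Q \<Longrightarrow> \<delta>1 \<le> circle_dist q"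
    using finite_pos_lower_bound[of Q circle_dist] Qpos by (auto simp: Q_def)
  \<comment> \<open>The number of bumps, hence the loss in the Fourier bound.\<close>
  define N where "N = 2 * real L + 1"
  have N: "N > 0" by (simp add: N_def add_nonneg_pos)
  \<comment> \<open>From frequency \<open>M\<close> on, the logarithm absorbs the number of bumps
    and the constant 16, independently of the width.\<close>
  obtain M :: nat where M: "M \<ge> 2" "N * 16 \<le> \<omega> * ln (real M)"
  proof -
    have "filterlim (\<lambda>m::nat. \<omega> * ln (real m)) at_top sequentially"
      using \<omega> by (intro filterlim_tendsto_pos_mult_at_top[OF tendsto_const]
          filterlim_compose[OF ln_at_top filterlim_real_sequentially])
    then have "eventually (\<lambda>m. N * 16 \<le> \<omega> * ln (real m)) sequentially"
      by (simp add: filterlim_at_top)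
    then have "eventually (\<lambda>m. m \<ge> 2 \<and> N * 16 \<le> \<omega> * ln (real m)) sequentially"
      using eventually_ge_at_top[of 2] by eventually_elim auto
    then show ?thesis using that by (auto simp: eventually_sequentially)
  qed
  \<comment> \<open>Below \<open>M\<close> the target is at least \<omega> ln 2 / M, and this is
    shared among the \<open>N\<close> bumps.\<close>
  define \<eta> where "\<eta> = \<omega> * ln 2 / (real M * N)"
  have \<eta>: "\<eta> > 0" using \<omega> M N by (simp add: \<eta>_def)
  obtain \<delta>0 where \<delta>0: "\<delta>0 > 0"
    "\<And>\<delta> n. \<lbrakk>0 < \<delta>; \<delta> \<le> \<delta>0\<rbrakk> \<Longrightarrow> norm (fourier_coeff (bump \<delta>) n) \<le> \<eta>"
    using fourier_bump_small[OF \<eta>] by blast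
  define \<delta> where "\<delta> = min \<delta>0 (\<delta>1 / 2)"
  have \<delta>: "\<delta> > 0" "\<delta> \<le> \<delta>0" "2 * \<delta> \<le> \<delta>1"
    using \<delta>0(1) \<delta>1(1) by (auto simp: \<delta>_def)
  have disj: "bump \<delta> x = 0 \<or> bump \<delta> y = 0" if "x - y \<in> Q" for x y
    using that \<delta> \<delta>1(2)[OF that] by (intro bump_disjoint) auto
  have bumpQ: "bump \<delta> x = 0" if "x \<in> Q" for x
    using disj[of x 0] that by simp
  define E where "E = (\<lambda>x. \<Sum>j\<in>{-int L..int L}. tent L j * bump \<delta> (x - p j))"
  \<comment> \<open>At most one summand is nonzero. The extra index -L-1 is there because
    translating by \<alpha> moves the bump at -L to it.\<close>
  have sum1: "(\<Sum>j\<in>{-int L-1..int L}. bump \<delta> (x - p j)) \<le> 1" for x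
  proof (cases "\<exists>j\<in>{-int L-1..int L}. bump \<delta> (x - p j) \<noteq> 0")
    case True
    then obtain i where i: "i \<in> {-int L-1..int L}" "bump \<delta> (x - p i) \<noteq> 0" by blast
    have "bump \<delta> (x - p j) = 0" if "j \<in> {-int L-1..int L} - {i}" for j
    proof -
      have "p (i - j) \<in> Q" using i that by (intro pQ) (auto simp: K_def)
      then have "(x - p j) - (x - p i) \<in> Q"
        by (simp add: p_diff)
      from disj[OF this] i show ?thesis by simp
    qed
    then have "(\<Sum>j\<in>{-int L-1..int L}. bump \<delta> (x - p j)) = (\<Sum>j\<in>{i}. bump \<delta> (x - p j))"
      using i(1) by (intro sum.mono_neutral_right) auto
    then show ?thesis using bump_le_1[OF \<delta>(1)] by simp
  next
    case False
    then have "(\<Sum>j\<in>{-int L-1..int L}. bump \<delta> (x - p j)) = 0"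
      by (intro sum.neutral) auto
    then show ?thesis by simp
  qed
  have E_ext: "E x = (\<Sum>j\<in>{-int L-1..int L}. tent L j * bump \<delta> (x - p j))" for x
    unfolding E_def by (rule sum.mono_neutral_left) (auto simp: tent_eq_0 L)
  have E_support: "\<exists>j\<in>{-int L<..<int L}. bump \<delta> (x - p j) \<noteq> 0" if "E x \<noteq> 0" for x
  proof (rule ccontr)
    assume "\<not> ?thesis"
    then have "tent L j * bump \<delta> (x - p j) = 0" for j
      using tent_eq_0[OF L, of j] by (cases "j \<in> {-int L<..<int L}") auto
    with that show False unfolding E_def by simp
  qed
  have cont: "continuous_on UNIV (\<lambda>x. bump \<delta> (x - p j))" for j
    by (intro continuous_on_circle_shift_diff continuous_bump \<delta>)
  have norm_four: "norm (fourier_coeff E n) \<le> N * norm (fourier_coeff (bump \<delta>) n)" for n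
  proof -
    have "fourier_coeff E n =
        (\<Sum>j\<in>{-int L..int L}. of_real (tent L j) * fourier_coeff (\<lambda>x. bump \<delta> (x - p j)) n)"
      unfolding E_def
      by (subst fourier_coeff_sum) (simp_all add: continuous_on_mult_left cont fourier_coeff_cmult)
    also have "norm \<dots> \<le> (\<Sum>j\<in>{-int L..int L}. 1 * norm (fourier_coeff (bump \<delta>) n))"
    proof (intro sum_norm_le)
      fix j
      have "norm (fourier_coeff (\<lambda>x. bump \<delta> (x - p j)) n) = norm (fourier_coeff (bump \<delta>) n)"
        using norm_fourier_coeff_shift[OF continuous_bump[OF \<delta>(1)], of "- p j"] by simp
      then show "norm (of_real (tent L j) * fourier_coeff (\<lambda>x. bump \<delta> (x - p j)) n)
          \<le> 1 * norm (fourier_coeff (bump \<delta>) n)"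
        by (simp add: norm_mult mult_left_le_one_le tent_le_1)
    qed
    also have "\<dots> = N * norm (fourier_coeff (bump \<delta>) n)"
      by (simp add: N_def)
    finally show ?thesis .
  qed
  show ?thesis
  proof (rule exI[of _ E], unfold_locales)
    show "continuous_on UNIV E"
      unfolding E_def by (intro continuous_intros cont)
    show "0 \<le> E x" for x
      unfolding E_def by (intro sum_nonneg mult_nonneg_nonneg) auto
    show "E x \<le> 1" for x
    proof -
      have "E x \<le> (\<Sum>j\<in>{-int L-1..int L}. bump \<delta> (x - p j))"
        unfolding E_ext by (intro sum_mono mult_left_le_one_le) (auto simp: tent_le_1)
      then show ?thesis using sum1 by (rule order_trans)
    qed
    show "E 0 = 1"
    proof -
      have "bump \<delta> (0 - p j) = 0" if "j \<in> {-int L..int L} - {0}" for j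
      proof (rule bumpQ)
        show "0 - p j \<in> Q"
          using pQ[of "0 - j"] that p_diff[of 0 j] by (simp add: K_def abs_le_iff)
      qed
      then have "E 0 = (\<Sum>j\<in>{0}. tent L j * bump \<delta> (0 - p j))"
        unfolding E_def by (intro sum.mono_neutral_right) auto
      then show ?thesis by simp
    qed
    show "\<bar>E (x + to_circle \<alpha>) - E x\<bar> \<le> 1 / real L" for x
    proof -
      \<comment> \<open>Rotation only renumbers the bumps, so the increment of \<open>E\<close>
        compares neighbouring tent weights on the same bumps.\<close>
      have "E (x + p 1) = (\<Sum>j\<in>{-int L-1..int L-1}. tent L (j + 1) * bump \<delta> (x - p j))"
        unfolding E_def
        by (rule sum.reindex_bij_witness[of _ "\<lambda>j. j + 1" "\<lambda>j. j - 1"])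
           (auto simp: p_diff algebra_simps)
      also have "\<dots> = (\<Sum>j\<in>{-int L-1..int L}. tent L (j + 1) * bump \<delta> (x - p j))"
        by (rule sum.mono_neutral_left) (auto simp: tent_eq_0 L)
      finally have "E (x + p 1) - E x =
          (\<Sum>j\<in>{-int L-1..int L}. (tent L (j + 1) - tent L j) * bump \<delta> (x - p j))"
        by (simp add: E_ext left_diff_distrib sum_subtractf)
      also have "\<bar>\<dots>\<bar> \<le> (\<Sum>j\<in>{-int L-1..int L}. 1 / real L * bump \<delta> (x - p j))"
        by (rule order_trans[OF sum_abs])
           (auto simp: abs_mult intro!: sum_mono mult_right_mono tent_lipschitz L
             simp del: times_divide_eq_left)
      also have "\<dots> \<le> 1 / real L * 1"
        unfolding sum_distrib_left[symmetric] by (intro mult_left_mono sum1) auto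
      finally show ?thesis by (simp add: p1)
    qed
    show "E (to_circle (of_int n * \<alpha>)) = 0" if "int L \<le> \<bar>n\<bar>" "\<bar>n\<bar> \<le> int R" for n
    proof (rule ccontr)
      assume "\<not> ?thesis"
      then obtain j where j: "j \<in> {-int L<..<int L}" "bump \<delta> (p n - p j) \<noteq> 0"
        using E_support[of "p n"] by (auto simp: p_def)
      have "p (n - j) \<in> Q"
        using that j(1) by (intro pQ) (auto simp: K_def)
      then have "p n - p j \<in> Q"
        by (simp add: p_diff)
      with j(2) bumpQ show False by blast
    qed
    show "E (to_circle (1/2 + of_int n * \<alpha>)) = 0" if "\<bar>n\<bar> \<le> int R" for n
    proof (rule ccontr)
      assume "\<not> ?thesis"
      then obtain j where j: "j \<in> {-int L<..<int L}" "bump \<delta> (h + p n - p j) \<noteq> 0"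
        using E_support[of "h + p n"] by (auto simp: hp)
      have "h + p (n - j) \<in> Q"
        using that j(1) by (intro hQ) (auto simp: K_def)
      then have "h + p n - p j \<in> Q"
        by (simp add: p_diff add_diff_eq)
      with j(2) bumpQ show False by blast
    qed
    show "E x = 0 \<or> E (x - to_circle (1/2 + of_int n * \<alpha>)) = 0" if n: "\<bar>n\<bar> \<le> int R" for n x
    proof (rule ccontr)
      assume "\<not> ?thesis"
      then obtain i j where i: "i \<in> {-int L<..<int L}" "bump \<delta> (x - p i) \<noteq> 0"
        and j: "j \<in> {-int L<..<int L}" "bump \<delta> (x - (h + p n) - p j) \<noteq> 0"
        using E_support[of x] E_support[of "x - (h + p n)"] unfolding hp by blast
      \<comment> \<open>Overlapping supports would make two bumps nonzero at arguments whose
        difference is this element of \<open>Q\<close>.\<close>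
      have "h + p (n + j - i) \<in> Q"
        using n i(1) j(1) by (intro hQ) (auto simp: K_def)
      also have "h + p (n + j - i) = (x - p i) - (x - (h + p n) - p j)"
        by (simp add: p_add p_diff algebra_simps)
      finally show False
        using disj i(2) j(2) by blast
    qed
    show "norm (fourier_coeff E n) \<le> \<omega> * (ln \<bar>of_int n\<bar> / \<bar>of_int n\<bar>)" if n: "\<bar>n\<bar> \<ge> 2" for n
    proof (cases "\<bar>n\<bar> \<ge> int M")
      case True
      then have "real M \<le> \<bar>of_int n\<bar>" by linarith
      then have "ln (real M) \<le> ln \<bar>of_int n\<bar>"
        using M n by (subst ln_le_cancel_iff) auto
      then have "N * 16 \<le> \<omega> * ln \<bar>of_int n\<bar>"
        using M(2) \<omega> by (meson mult_left_mono less_imp_le order_trans)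
      then have "N * 16 / \<bar>of_int n\<bar> \<le> \<omega> * ln \<bar>of_int n\<bar> / \<bar>of_int n\<bar>"
        by (intro divide_right_mono) auto
      moreover have "N * norm (fourier_coeff (bump \<delta>) n) \<le> N * (16 / \<bar>of_int n\<bar>)"
        using norm_fourier_bump_le[OF \<delta>(1), of n] n N by (intro mult_left_mono) auto
      ultimately show ?thesis
        using norm_four[of n] by simp
    next
      case False
      then have nM: "\<bar>of_int n\<bar> \<le> real M" by linarith
      have ln2: "ln 2 \<le> ln \<bar>real_of_int n\<bar>"
        using n by (subst ln_le_cancel_iff) auto
      have "norm (fourier_coeff E n) \<le> N * norm (fourier_coeff (bump \<delta>) n)"
        by (rule norm_four)
      also have "\<dots> \<le> N * \<eta>"
        using \<delta>0(2)[OF \<delta>(1,2), of n] N by (intro mult_left_mono) auto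
      also have "\<dots> = \<omega> * (ln 2 / real M)"
        using N M by (simp add: \<eta>_def)
      also have "\<dots> \<le> \<omega> * (ln \<bar>of_int n\<bar> / \<bar>of_int n\<bar>)"
        using \<omega> nM n M ln2 by (intro mult_left_mono frac_le) auto
      finally show ?thesis .
    qed
  qed
qed

section \<open>Coboundaries of tower functions\<close>

text \<open>Telescoping; the sign convention for negative times yields one formula for all
  \<open>n\<close>.\<close>

lemma birkhoff_sum_coboundary:
  "birkhoff_sum \<alpha> (\<lambda>x. z x - z (x + to_circle \<alpha>)) n x = z x - z (x + to_circle (of_int n * \<alpha>))"
proof (cases "n \<ge> 0")
  case True
  have "(\<Sum>k<m. z (x + to_circle (real k * \<alpha>)) - z (x + to_circle (real k * \<alpha>) + to_circle \<alpha>)) =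
      z x - z (x + to_circle (real m * \<alpha>))" for m
  proof (induction m)
    case 0
    show ?case by (simp add: to_circle_0)
  next
    case (Suc m)
    have step: "x + to_circle (real m * \<alpha>) + to_circle \<alpha> = x + to_circle (real (Suc m) * \<alpha>)"
      by (simp add: to_circle_add ring_distribs add_ac)
    show ?case
      unfolding sum.lessThan_Suc Suc step by simp
  qed
  from this[of "nat n"] True show ?thesis
    by (simp add: birkhoff_sum_def)
next
  case False
  have "(\<Sum>k=1..m. z (x - to_circle (real k * \<alpha>)) - z (x - to_circle (real k * \<alpha>) + to_circle \<alpha>)) =
      z (x - to_circle (real m * \<alpha>)) - z x" for m
  proof (induction m)
    case 0
    show ?case by (simp add: to_circle_0)
  next
    case (Suc m)
    have step: "x - to_circle (real (Suc m) * \<alpha>) + to_circle \<alpha> = x - to_circle (real m * \<alpha>)"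
      by (simp add: to_circle_add ring_distribs)
    show ?case
      using Suc arg_cong[OF step, of z] by (simp del: of_nat_Suc)
  qed
  moreover have "x + to_circle (of_int n * \<alpha>) = x - to_circle (real (nat \<bar>n\<bar>) * \<alpha>)"
    using False by (simp flip: to_circle_minus)
  ultimately show ?thesis
    using False by (simp add: birkhoff_sum_def)
qed

lemma birkhoff_sum_sums:
  assumes "\<And>x. (\<lambda>k. f k x) sums \<phi> x"
  shows "(\<lambda>k. birkhoff_sum \<alpha> (f k) n x) sums birkhoff_sum \<alpha> \<phi> n x"
  unfolding birkhoff_sum_def
  by (cases "n \<ge> 0") (simp_all add: sums_minus sums_sum assms)

text \<open>Height 4^k over 8^k steps gives increments of order 2^-k, and the Fourier budget 16^-k
  against height 4^k leaves 4^-k; both are summable. The horizon covers the times |n| < 8^(k+1) on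
  the orbit of 0 and the times up to \<open>N k\<close> on that of 1/2. The gaps between the
  \<open>N k\<close> keep later second humps away from earlier ones.\<close>

locale tower_sequence =
  fixes \<alpha> :: real and N :: "nat \<Rightarrow> nat" and E :: "nat \<Rightarrow> circle \<Rightarrow> real" and r :: "nat \<Rightarrow> real"
  assumes tower: "tower \<alpha> (1 / 16 ^ k) (8 ^ k) (N k + 8 ^ Suc k) (E k)"
    and N_ge: "8 ^ k \<le> N k" and N_gap: "i < k \<Longrightarrow> N i + 8 ^ k \<le> N k"
    and r_bound: "\<bar>r k\<bar> \<le> 4 ^ k / 6"
begin

lemmas E_cont = tower.continuous[OF tower]
  and E_nonneg = tower.nonneg[OF tower]
  and E_le_1 = tower.le_1[OF tower]
  and E_0 = tower.at_0[OF tower]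
  and E_orbit_half = tower.orbit_half[OF tower]
  and E_fourier = tower.fourier[OF tower]

lemma E_step: "\<bar>E k (x + to_circle \<alpha>) - E k x\<bar> \<le> 1 / 8 ^ k"
  using tower.step[OF tower, of k x] by simp

lemma E_orbit_0:
  "\<lbrakk>8 ^ k \<le> \<bar>j\<bar>; \<bar>j\<bar> \<le> int (N k + 8 ^ Suc k)\<rbrakk> \<Longrightarrow> E k (to_circle (of_int j * \<alpha>)) = 0"
  by (rule tower.orbit_0[OF tower]) simp_all

lemma E_disjoint: "E k x = 0 \<or> E k (x - to_circle (1/2 + real (N k) * \<alpha>)) = 0"
  using tower.disjoint[OF tower, of "int (N k)" k x] by simp

section \<open>The two-humped transfer functions and the heights of the second humps\<close>

definition y :: "nat \<Rightarrow> circle"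
  where "y k = to_circle (1/2 + real (N k) * \<alpha>)"

text \<open>
  The summands are the values \<open>z i (y k)\<close> defined below, so \<open>\<beta>\<close> solves
  \<open>(\<Sum>i\<le>k. z i (y k)) = - r k\<close>, as \<open>z k (y k) = \<beta> k\<close>.
\<close>

fun \<beta> :: "nat \<Rightarrow> real"
  where "\<beta> k = - r k - (\<Sum>i<k. 4 ^ i * E i (y k) + \<beta> i * E i (y k - y i))"

declare \<beta>.simps [simp del]

definition z :: "nat \<Rightarrow> circle \<Rightarrow> real"
  where "z k x = 4 ^ k * E k x + \<beta> k * E k (x - y k)"

lemma z_cases:
  obtains "z k x = 4 ^ k * E k x" | "z k x = \<beta> k * E k (x - y k)"
  using E_disjoint[of k x] by (auto simp: z_def y_def)

text \<open>Conditional on the bound for \<open>\<beta> k\<close>, since the induction proving that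
  bound uses this estimate for smaller indices. Disjointness of the humps makes their heights not
  add up.\<close>

lemma abs_z_le_aux:
  assumes "\<bar>\<beta> k\<bar> \<le> 4 ^ k / 2"
  shows "\<bar>z k x\<bar> \<le> 4 ^ k"
proof (cases k x rule: z_cases)
  case 1
  then show ?thesis
    using E_nonneg[of k x] E_le_1[of k x] by (simp add: abs_mult)
next
  case 2
  have "\<bar>\<beta> k\<bar> * E k (x - y k) \<le> (4 ^ k / 2) * 1"
    by (intro mult_mono assms E_nonneg E_le_1) auto
  also have "\<dots> \<le> 4 ^ k"
    by simp
  finally have "\<bar>\<beta> k\<bar> * E k (x - y k) \<le> 4 ^ k" .
  then show ?thesis
    using 2 E_nonneg[of k "x - y k"] by (simp add: abs_mult)
qed

text \<open>Strong induction: the prescribed value costs 4^k / 6 and the earlier \<open>z i\<close>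
  together less than 4^k / 3.\<close>

lemma abs_beta_le: "\<bar>\<beta> k\<bar> \<le> 4 ^ k / 2"
proof (induction k rule: less_induct)
  case (less k)
  have "\<beta> k = - r k - (\<Sum>i<k. z i (y k))"
    by (subst \<beta>.simps) (simp add: z_def)
  then have "\<bar>\<beta> k\<bar> \<le> \<bar>r k\<bar> + \<bar>\<Sum>i<k. z i (y k)\<bar>"
    by simp
  also have "\<bar>\<Sum>i<k. z i (y k)\<bar> \<le> (\<Sum>i<k. 4 ^ i)"
    using less by (intro order_trans[OF sum_abs] sum_mono abs_z_le_aux) auto
  also have "\<dots> \<le> 4 ^ k / (3::real)"
    by (simp add: geometric_sum)
  finally show ?case using r_bound[of k] by simp
qed

lemma abs_z_le: "\<bar>z k x\<bar> \<le> 4 ^ k"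
  by (intro abs_z_le_aux abs_beta_le)

lemma z_cont: "continuous_on UNIV (z k)"
  unfolding z_def
  by (intro continuous_on_add continuous_on_mult_left E_cont continuous_on_circle_shift_diff)

section \<open>The cocycle as a uniformly convergent sum of coboundaries\<close>

definition f :: "nat \<Rightarrow> circle \<Rightarrow> real"
  where "f k x = z k x - z k (x + to_circle \<alpha>)"

lemma f_cont: "continuous_on UNIV (f k)"
  unfolding f_def by (intro continuous_on_diff z_cont continuous_on_circle_shift)

lemma abs_f_le: "\<bar>f k x\<bar> \<le> 2 * (1/2) ^ k"
proof -
  have "f k x = - (4 ^ k * (E k (x + to_circle \<alpha>) - E k x) +
      \<beta> k * (E k (x - y k + to_circle \<alpha>) - E k (x - y k)))"
    by (simp add: f_def z_def algebra_simps)
  also have "\<bar>\<dots>\<bar> \<le> \<bar>4 ^ k\<bar> * \<bar>E k (x + to_circle \<alpha>) - E k x\<bar> +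
      \<bar>\<beta> k\<bar> * \<bar>E k (x - y k + to_circle \<alpha>) - E k (x - y k)\<bar>"
    unfolding abs_minus_cancel abs_mult[symmetric] by (rule abs_triangle_ineq)
  also have "\<dots> \<le> 4 ^ k * (1 / 8 ^ k) + 4 ^ k * (1 / 8 ^ k)"
    using abs_beta_le[of k] by (intro add_mono mult_mono E_step) auto
  also have "\<dots> = 2 * (4 / 8) ^ k"
    unfolding power_divide by simp
  finally show ?thesis by simp
qed

definition \<phi> :: "circle \<Rightarrow> real"
  where "\<phi> x = (\<Sum>k. f k x)"

lemma phi_uniform: "uniform_limit UNIV (\<lambda>n x. \<Sum>k<n. f k x) \<phi> sequentially"
  unfolding \<phi>_def
  by (rule Weierstrass_m_test[of _ _ "\<lambda>k. 2 * (1/2) ^ k"])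
     (auto simp: abs_f_le intro!: summable_mult summable_geometric)

lemma phi_cont: "continuous_on UNIV \<phi>"
  by (rule uniform_limit_theorem[OF _ phi_uniform]) (simp_all add: continuous_on_sum f_cont)

lemma phi_sums: "(\<lambda>k. f k x) sums \<phi> x"
  using tendsto_uniform_limitI[OF phi_uniform, of x] by (simp add: sums_def)

text \<open>The \<open>z k\<close> themselves are not summable at 0, where they equal 4^k; only
  their differences along an orbit are.\<close>

lemma birkhoff_sums: "(\<lambda>k. z k x - z k (x + to_circle (of_int n * \<alpha>))) sums birkhoff_sum \<alpha> \<phi> n x"
  using birkhoff_sum_sums[of f \<phi>, OF phi_sums, of \<alpha> n x]
  unfolding f_def[abs_def] birkhoff_sum_coboundary .

section \<open>The discrete orbit of 0\<close>

lemma z_0: "z k 0 = 4 ^ k"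
  using E_disjoint[of k 0] E_0[of k] by (simp add: z_def y_def)

text \<open>Each \<open>z i\<close> is maximal at 0, so no term is negative. In the k-th term the
  first hump has vanished at time \<open>n\<close>, and the second takes back at most half of
  4^k.\<close>

lemma birkhoff_0_ge:
  assumes "8 ^ k \<le> \<bar>n\<bar>" "\<bar>n\<bar> < 8 ^ Suc k"
  shows "4 ^ k / 2 \<le> birkhoff_sum \<alpha> \<phi> n 0"
proof -
  define u where "u = (\<lambda>k. z k 0 - z k (to_circle (of_int n * \<alpha>)))"
  have u: "u sums birkhoff_sum \<alpha> \<phi> n 0"
    using birkhoff_sums[of 0 n] by (simp add: u_def)
  have "0 \<le> u i" for i
    using abs_z_le[of i "to_circle (of_int n * \<alpha>)"] by (simp add: u_def z_0)
  then have "sum u {k} \<le> suminf u"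
    using u by (intro sum_le_suminf) (auto simp: sums_iff)
  moreover have "4 ^ k / 2 \<le> u k"
  proof -
    have "\<bar>n\<bar> \<le> int (N k + 8 ^ Suc k)" using assms(2) by simp
    then have "E k (to_circle (of_int n * \<alpha>)) = 0"
      using assms(1) by (intro E_orbit_0)
    then have "u k = 4 ^ k - \<beta> k * E k (to_circle (of_int n * \<alpha>) - y k)"
      by (simp add: u_def z_0) (simp add: z_def)
    moreover have "\<beta> k * E k (to_circle (of_int n * \<alpha>) - y k) \<le> (4 ^ k / 2) * 1"
      using abs_beta_le[of k] by (intro mult_mono E_nonneg E_le_1) auto
    ultimately show ?thesis by simp
  qed
  ultimately show ?thesis using u by (simp add: sums_iff)
qed

lemma discrete_orbit_0: "discrete_orbit \<alpha> \<phi> (0, t)"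
  unfolding discrete_orbit_def filterlim_at_top eventually_filtercomap_at_top_linorder
proof
  fix Z :: real
  obtain K where K: "2 * Z < 4 ^ K"
    using real_arch_pow[of 4 "2 * Z"] by auto
  show "\<exists>M. \<forall>n. M \<le> \<bar>n\<bar> \<longrightarrow> Z \<le> \<bar>birkhoff_sum \<alpha> \<phi> n (fst (0, t))\<bar>"
  proof (intro exI allI impI)
    fix n :: int
    assume n: "8 ^ K \<le> \<bar>n\<bar>"
    then have "1 \<le> nat \<bar>n\<bar>"
      using zero_less_power[of "8::int" K] by linarith
    \<comment> \<open>The ranges of \<open>birkhoff_0_ge\<close> cover all nonzero times, so no
      times of small growth are left between scales.\<close>
    then obtain k where k: "8 ^ k \<le> nat \<bar>n\<bar>" "nat \<bar>n\<bar> < 8 ^ (k + 1)"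
      using ex_power_ivl1[of 8 "nat \<bar>n\<bar>"] by auto
    then have k': "8 ^ k \<le> \<bar>n\<bar>" "\<bar>n\<bar> < 8 ^ Suc k"
      by (simp_all add: nat_less_iff le_nat_iff)
    have "(8::int) ^ K < 8 ^ Suc k"
      using n k'(2) by linarith
    then have "K \<le> k" by (simp only: power_strict_increasing_iff)
    then have "(4::real) ^ K \<le> 4 ^ k" by (intro power_increasing) auto
    then show "Z \<le> \<bar>birkhoff_sum \<alpha> \<phi> n (fst (0, t))\<bar>"
      using birkhoff_0_ge[OF k'] K unfolding fst_conv by linarith
  qed
qed

section \<open>Prescribed values along the orbit of 1/2\<close>

lemma z_half: "z k (to_circle (1/2)) = 0"
proof -
  have "(8::int) ^ k \<le> int (N k)"
    using of_nat_mono[OF N_ge[of k], where 'a = int] by simp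
  \<comment> \<open>Seen from the centre of the second hump, 1/2 lies at time \<open>- N k\<close>,
    which is beyond the 8^k steps of the descent.\<close>
  then have "E k (to_circle (of_int (- int (N k)) * \<alpha>)) = 0"
    by (intro E_orbit_0) simp_all
  moreover have "to_circle (of_int (- int (N k)) * \<alpha>) = to_circle (1/2) - y k"
    by (simp add: y_def flip: to_circle_diff)
  ultimately show ?thesis
    using E_orbit_half[of 0 k] by (simp add: z_def)
qed

text \<open>Seen from \<open>y k\<close>, the point \<open>y i\<close> lies at a time of modulus at
  least 8^k by \<open>N_gap\<close>, hence outside the second hump. Later stages therefore do not
  disturb the values arranged at earlier ones.\<close>

lemma z_y_later:
  assumes "i < k"
  shows "z k (y i) = 0"
proof -
  have gap: "int (N i) + 8 ^ k \<le> int (N k)"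
    using of_nat_mono[OF N_gap[OF assms], where 'a = int] by simp
  have pos: "(0::int) \<le> 8 ^ k" by simp
  have "\<bar>int (N i)\<bar> \<le> int (N k + 8 ^ Suc k)"
    using gap pos by (simp del: zero_le_power zero_le_numeral)
  then have "E k (to_circle (1/2 + of_int (int (N i)) * \<alpha>)) = 0"
    by (rule E_orbit_half)
  moreover have "E k (to_circle (of_int (int (N i) - int (N k)) * \<alpha>)) = 0"
    using gap pos by (intro E_orbit_0) (simp_all del: zero_le_power zero_le_numeral)
  moreover have "to_circle (of_int (int (N i) - int (N k)) * \<alpha>) = y i - y k"
    by (simp add: y_def left_diff_distrib flip: to_circle_diff)
  ultimately show ?thesis
    by (simp add: z_def y_def)
qed

text \<open>The series is reduced to the terms \<open>- z k (y i)\<close> with \<open>k\<close> at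
  most \<open>i\<close>, and \<open>\<beta> i\<close> was chosen to make these add up to
  \<open>r i\<close>.\<close>

lemma birkhoff_half: "birkhoff_sum \<alpha> \<phi> (int (N i)) (to_circle (1/2)) = r i"
proof -
  have "to_circle (1/2) + to_circle (of_int (int (N i)) * \<alpha>) = y i"
    by (simp add: y_def to_circle_add)
  then have "(\<lambda>k. - z k (y i)) sums birkhoff_sum \<alpha> \<phi> (int (N i)) (to_circle (1/2))"
    using birkhoff_sums[of "to_circle (1/2)" "int (N i)"] by (simp add: z_half)
  moreover have "(\<lambda>k. - z k (y i)) sums (\<Sum>k\<in>{..i}. - z k (y i))"
    by (rule sums_finite) (auto simp: z_y_later)
  ultimately have "birkhoff_sum \<alpha> \<phi> (int (N i)) (to_circle (1/2)) = (\<Sum>k\<in>{..i}. - z k (y i))"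
    by (rule sums_unique2)
  also have "\<dots> = - (z i (y i)) - (\<Sum>k<i. z k (y i))"
    by (simp add: sum_negf flip: lessThan_Suc_atMost)
  also have "z i (y i) = \<beta> i"
    using E_orbit_half[of "int (N i)" i] by (simp add: z_def y_def E_0)
  also have "\<beta> i = - r i - (\<Sum>k<i. z k (y i))"
    by (subst \<beta>.simps) (simp add: z_def)
  finally show ?thesis by simp
qed

lemma orbit_half: "(y i, r i) \<in> two_sided_orbit (cylindrical \<alpha> \<phi>) (to_circle (1/2), 0)"
  unfolding two_sided_orbit_cylindrical
  by (rule image_eqI[of _ _ "int (N i)"]) (simp_all add: birkhoff_half y_def to_circle_add)

section \<open>Fourier decay of the cocycle\<close>

lemma fourier_f_le:
  assumes "\<bar>n\<bar> \<ge> 2"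
  shows "norm (fourier_coeff (f k) n) \<le> 3 * (1/4) ^ k * (ln \<bar>of_int n\<bar> / \<bar>of_int n\<bar>)"
proof -
  let ?e = "norm (fourier_coeff (E k) n)"
  have Ey: "norm (fourier_coeff (\<lambda>x. E k (x - y k)) n) = ?e"
    using norm_fourier_coeff_shift[OF E_cont[of k], of "- y k"] by simp
  have cont: "continuous_on UNIV (\<lambda>x. 4 ^ k * E k x)" "continuous_on UNIV (\<lambda>x. \<beta> k * E k (x - y k))"
    by (intro continuous_on_mult_left E_cont continuous_on_circle_shift_diff)+
  \<comment> \<open>The two heights contribute the factor 3/2 times 4^k; the coboundary doubles it,
    and the budget 16^-k turns 4^k into 4^-k.\<close>
  have "fourier_coeff (z k) n =
      of_real (4 ^ k) * fourier_coeff (E k) n + of_real (\<beta> k) * fourier_coeff (\<lambda>x. E k (x - y k)) n"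
    unfolding z_def fourier_coeff_add[OF cont] fourier_coeff_cmult ..
  then have "norm (fourier_coeff (z k) n) \<le> 4 ^ k * ?e + \<bar>\<beta> k\<bar> * ?e"
    using norm_triangle_ineq[of "of_real (4 ^ k) * fourier_coeff (E k) n"
        "of_real (\<beta> k) * fourier_coeff (\<lambda>x. E k (x - y k)) n"]
    by (simp add: norm_mult Ey norm_power)
  also have "\<dots> \<le> 4 ^ k * ?e + 4 ^ k / 2 * ?e"
    by (intro add_left_mono mult_right_mono abs_beta_le) auto
  finally have zk: "norm (fourier_coeff (z k) n) \<le> 3/2 * (4 ^ k * ?e)"
    by (simp add: mult.commute)
  have "fourier_coeff (f k) n = fourier_coeff (z k) n - fourier_coeff (\<lambda>x. z k (x + to_circle \<alpha>)) n"
    unfolding f_def by (intro fourier_coeff_diff z_cont continuous_on_circle_shift)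
  then have "norm (fourier_coeff (f k) n) \<le> 2 * norm (fourier_coeff (z k) n)"
    using norm_triangle_ineq4[of "fourier_coeff (z k) n"] norm_fourier_coeff_shift[OF z_cont[of k], of "to_circle \<alpha>" n]
    by (metis mult_2)
  also have "\<dots> \<le> 3 * (4 ^ k * ?e)"
    using zk by linarith
  also have "\<dots> \<le> 3 * (4 ^ k * (1 / 16 ^ k * (ln \<bar>of_int n\<bar> / \<bar>of_int n\<bar>)))"
    by (intro mult_left_mono E_fourier assms) auto
  also have "\<dots> = 3 * (4 / 16) ^ k * (ln \<bar>of_int n\<bar> / \<bar>of_int n\<bar>)"
    unfolding power_divide by simp
  finally show ?thesis by simp
qed

text \<open>The bounds for the \<open>f k\<close> form a geometric series with sum 3 * (4/3) = 4;
  uniform convergence carries the bound from the partial sums to the limit, up to an arbitrary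
  \<open>e\<close>.\<close>

lemma fourier_phi_le:
  assumes "\<bar>n\<bar> \<ge> 2"
  shows "norm (fourier_coeff \<phi> n) \<le> 4 * (ln \<bar>of_int n\<bar> / \<bar>of_int n\<bar>)"
proof (rule field_le_epsilon)
  fix e :: real assume "e > 0"
  let ?\<rho> = "ln \<bar>real_of_int n\<bar> / \<bar>real_of_int n\<bar>"
  have \<rho>: "?\<rho> \<ge> 0" using assms by auto
  obtain K where K: "\<And>x. \<bar>(\<Sum>k<K. f k x) - \<phi> x\<bar> < e"
    using uniform_limitD[OF phi_uniform \<open>e > 0\<close>]
    by (auto simp: eventually_sequentially dist_real_def)
  define S where "S = (\<lambda>x. \<Sum>k<K. f k x)"
  have S: "continuous_on UNIV S"
    unfolding S_def by (intro continuous_on_sum f_cont)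
  have "norm (fourier_coeff S n) \<le> (\<Sum>k<K. 3 * (1/4) ^ k * ?\<rho>)"
    unfolding S_def fourier_coeff_sum[OF finite_lessThan f_cont]
    by (intro sum_norm_le fourier_f_le assms)
  also have "\<dots> = 3 * (\<Sum>k<K. (1/4) ^ k) * ?\<rho>"
    by (simp only: sum_distrib_left sum_distrib_right)
  also have "\<dots> \<le> 3 * (4/3) * ?\<rho>"
    using \<rho> geometric_sum_less[of "1/4 :: real" "{..<K}"]
    by (intro mult_right_mono mult_left_mono) auto
  finally have "norm (fourier_coeff S n) \<le> 4 * ?\<rho>" by simp
  moreover have "norm (fourier_coeff (\<lambda>x. S x - \<phi> x) n) \<le> e"
    using K by (intro norm_fourier_coeff_le continuous_on_diff S phi_cont) (auto simp: S_def less_imp_le)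
  ultimately show "norm (fourier_coeff \<phi> n) \<le> 4 * ?\<rho> + e"
    using norm_triangle_ineq4[of "fourier_coeff S n" "fourier_coeff S n - fourier_coeff \<phi> n"]
    by (simp add: fourier_coeff_diff[OF S phi_cont])
qed

lemma fourier_phi_bigo:
  "(\<lambda>n. norm (fourier_coeff \<phi> n)) \<in> O[int_at_infinity](\<lambda>n. ln \<bar>of_int n\<bar> / \<bar>of_int n\<bar>)"
proof (rule bigoI[of _ 4])
  show "\<forall>\<^sub>F n in int_at_infinity.
      norm (norm (fourier_coeff \<phi> n)) \<le> 4 * norm (ln \<bar>real_of_int n\<bar> / \<bar>real_of_int n\<bar>)"
    unfolding eventually_filtercomap_at_top_linorder
  proof (intro exI[of _ 2] allI impI)
    fix n :: int assume n: "2 \<le> \<bar>n\<bar>"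
    have "4 * (ln \<bar>real_of_int n\<bar> / \<bar>real_of_int n\<bar>) \<le> 4 * norm (ln \<bar>real_of_int n\<bar> / \<bar>real_of_int n\<bar>)"
      unfolding real_norm_def by (intro mult_left_mono abs_ge_self) auto
    then show "norm (norm (fourier_coeff \<phi> n)) \<le> 4 * norm (ln \<bar>real_of_int n\<bar> / \<bar>real_of_int n\<bar>)"
      using fourier_phi_le[OF n] by simp
  qed
qed

section \<open>The Besicovitch property\<close>

lemma besicovitch_phi:
  assumes dense: "\<And>c0 r0 \<epsilon>. \<epsilon> > 0 \<Longrightarrow>
    \<exists>k. (\<exists>m::int. \<bar>1/2 + real (N k) * \<alpha> - of_int m - c0\<bar> < \<epsilon>) \<and> \<bar>r k - r0\<bar> < \<epsilon>"
  shows "besicovitch \<alpha> \<phi>"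
proof -
  let ?O = "two_sided_orbit (cylindrical \<alpha> \<phi>) (to_circle (1/2), 0)"
  \<comment> \<open>The points \<open>(y k, r k)\<close> of the orbit are already dense; the integer
    \<open>m\<close> in the assumption selects the lift of \<open>y k\<close> close to
    \<open>c0\<close>.\<close>
  have "p \<in> closure ?O" for p
    unfolding closure_iff_nhds_not_empty
  proof (intro allI impI)
    fix A V assume V: "V \<subseteq> A" "open V" "p \<in> V"
    obtain U I where UI: "open U" "open I" "p \<in> U \<times> I" "U \<times> I \<subseteq> V"
      by (rule open_prod_elim[OF V(2,3)])
    obtain c0 where c0: "fst p = to_circle c0"
      using surj_to_circle by (metis surjD)
    have "open (to_circle -` U)" "c0 \<in> to_circle -` U"
      using UI c0 by (auto simp: open_circle_def)
    then obtain e1 where e1: "e1 > 0" "ball c0 e1 \<subseteq> to_circle -` U"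
      by (meson open_contains_ball)
    obtain e2 where e2: "e2 > 0" "ball (snd p) e2 \<subseteq> I"
      using UI by (metis mem_Times_iff open_contains_ball)
    have "min e1 e2 > 0" using e1 e2 by simp
    from dense[OF this, of c0 "snd p"] obtain k m
      where m: "\<bar>1/2 + real (N k) * \<alpha> - of_int m - c0\<bar> < e1" and k: "\<bar>r k - snd p\<bar> < e2"
      by auto
    have "to_circle (1/2 + real (N k) * \<alpha> - of_int m) \<in> U"
      using m e1(2) by (auto simp: dist_real_def abs_minus_commute)
    then have "y k \<in> U"
      by (simp add: y_def to_circle_diff[of _ "of_int m"] to_circle_of_int)
    moreover have "r k \<in> I"
      using k e2(2) by (auto simp: dist_real_def abs_minus_commute)
    ultimately have "(y k, r k) \<in> A"
      using UI(4) V(1) by blast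
    with orbit_half[of k] show "?O \<inter> A \<noteq> {}" by blast
  qed
  then have "closure ?O = UNIV" by blast
  then show ?thesis
    unfolding besicovitch_def using discrete_orbit_0 by blast
qed

end

section \<open>Choice of the parameters\<close>

text \<open>Rational pairs are enumerated with a spare natural number, so every pair recurs at
  arbitrarily large indices, where the growing bound on \<open>r k\<close> admits it.\<close>

lemma dense_sequence:
  "\<exists>c r :: nat \<Rightarrow> real. (\<forall>k. \<bar>r k\<bar> \<le> 4 ^ k / 6) \<and>
     (\<forall>c0 r0 \<epsilon> K. \<epsilon> > 0 \<longrightarrow> (\<exists>k\<ge>K. \<bar>c k - c0\<bar> < \<epsilon> \<and> \<bar>r k - r0\<bar> < \<epsilon>))"
proof -
  define q :: "nat \<Rightarrow> rat \<times> rat \<times> nat" where "q = from_nat"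
  define c :: "nat \<Rightarrow> real" where "c = (\<lambda>k. of_rat (fst (q k)))"
  \<comment> \<open>The default 0 enforces the bound at indices where the enumerated value is still
    too large.\<close>
  define r :: "nat \<Rightarrow> real" where "r = (\<lambda>k. let b = of_rat (fst (snd (q k))) in if \<bar>b\<bar> \<le> 4 ^ k / 6 then b else 0)"
  have bound: "\<bar>r k\<bar> \<le> 4 ^ k / 6" for k
    by (simp add: r_def Let_def)
  have dense: "\<exists>k\<ge>K. \<bar>c k - c0\<bar> < \<epsilon> \<and> \<bar>r k - r0\<bar> < \<epsilon>" if \<epsilon>: "\<epsilon> > 0" for c0 r0 \<epsilon> K
  proof -
  obtain a where a: "\<bar>of_rat a - c0\<bar> < \<epsilon>"
    using of_rat_dense[of "c0 - \<epsilon>" "c0 + \<epsilon>"] \<epsilon> by (auto simp: abs_less_iff algebra_simps)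
  obtain b where b: "\<bar>of_rat b - r0\<bar> < \<epsilon>"
    using of_rat_dense[of "r0 - \<epsilon>" "r0 + \<epsilon>"] \<epsilon> by (auto simp: abs_less_iff algebra_simps)
  obtain K' where K': "6 * \<bar>of_rat b\<bar> < (4::real) ^ K'"
    using real_arch_pow[of 4 "6 * \<bar>of_rat b :: real\<bar>"] by auto
  have "infinite (range (\<lambda>m::nat. to_nat (a, b, m)))"
    by (intro range_inj_infinite injI) (auto dest: injD[OF inj_to_nat])
  then have "\<exists>n\<ge>max K K'. n \<in> range (\<lambda>m::nat. to_nat (a, b, m))"
    unfolding infinite_nat_iff_unbounded_le by blast
  then obtain m where m: "max K K' \<le> to_nat (a, b, m :: nat)"
    by blast
  define k where "k = to_nat (a, b, m)"
  have "(4::real) ^ K' \<le> 4 ^ k"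
    using m by (intro power_increasing) (auto simp: k_def)
  then have "\<bar>of_rat b\<bar> \<le> (4::real) ^ k / 6"
    using K' by linarith
  moreover have qk: "q k = (a, b, m)"
    by (simp add: q_def k_def)
  ultimately have "r k = of_rat b"
    by (simp only: r_def qk prod.sel Let_def if_P)
  then show ?thesis
    using m a b by (intro exI[of _ k]) (auto simp: c_def qk, simp add: k_def)
  qed
  show ?thesis
    using bound dense by (intro exI[of _ c] exI[of _ r]) blast
qed

lemma rotation_approx:
  fixes \<alpha> c \<epsilon> :: real and M :: nat
  assumes "\<alpha> \<notin> \<rat>" "\<epsilon> > 0"
  shows "\<exists>n\<ge>M. \<exists>m::int. \<bar>1/2 + real n * \<alpha> - of_int m - c\<bar> < \<epsilon>"
proof -
  \<comment> \<open>Density is applied to the target moved back by \<open>M\<close> rotation steps,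
    so that \<open>k + M\<close> is a time of at least \<open>M\<close>.\<close>
  obtain h k where k: "k > 0" "\<bar>of_int k * \<alpha> - of_int h - (c - 1/2 - real M * \<alpha>)\<bar> < \<epsilon>"
    using sequence_of_fractional_parts_is_dense[OF assms] by blast
  have "real (nat k + M) = of_int k + real M"
    using k(1) by simp
  then show ?thesis
    using k by (intro exI[of _ "nat k + M"] conjI exI[of _ h]) (simp_all add: algebra_simps)
qed

text \<open>Dependent choice of ever later times near the targets. It suffices to control
  consecutive gaps: for \<open>i < k\<close>, monotonicity gives \<open>N i\<close> at most
  \<open>N (k - 1)\<close>.\<close>

lemma separated_times:
  fixes \<alpha> :: real and c :: "nat \<Rightarrow> real"
  assumes "\<alpha> \<notin> \<rat>"
  shows "\<exists>N :: nat \<Rightarrow> nat. (\<forall>k. 8 ^ k \<le> N k) \<and> (\<forall>i k. i < k \<longrightarrow> N i + 8 ^ k \<le> N k) \<and>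
     (\<forall>k. \<exists>m::int. \<bar>1/2 + real (N k) * \<alpha> - of_int m - c k\<bar> < 1 / real (Suc k))"
proof -
  let ?P = "\<lambda>k n. 8 ^ k \<le> n \<and> (\<exists>m::int. \<bar>1/2 + real n * \<alpha> - of_int m - c k\<bar> < 1 / real (Suc k))"
  have "\<exists>N. \<forall>k. ?P k (N k) \<and> N k + 8 ^ Suc k \<le> N (Suc k)"
  proof (rule dependent_nat_choice)
    show "\<exists>n. ?P 0 n"
      by (rule rotation_approx[OF assms]) simp
    show "\<exists>n'. ?P (Suc k) n' \<and> n + 8 ^ Suc k \<le> n'" for n k
    proof -
      have "0 < 1 / real (Suc (Suc k))" by simp
      from rotation_approx[OF assms this, of "n + 8 ^ Suc k" "c (Suc k)"]
      show ?thesis by (metis add_leD2)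
    qed
  qed
  then obtain N where N: "\<And>k. ?P k (N k)" and step: "\<And>k. N k + 8 ^ Suc k \<le> N (Suc k)"
    by blast
  have mono: "N i \<le> N k" if "i \<le> k" for i k
    using step by (intro lift_Suc_mono_le[OF _ that]) (metis add_leD1)
  have gap: "N i + 8 ^ k \<le> N k" if "i < k" for i k
    using that mono[of i "k - 1"] step[of "k - 1"] by (simp add: le_diff_conv2 Suc_le_eq)
  show ?thesis
    using N gap by blast
qed

theorem theorem5:
  shows "\<exists>(\<alpha>::real) (\<phi>::circle \<Rightarrow> real).
           \<alpha> \<notin> \<rat> \<and> continuous_on UNIV \<phi> \<and> besicovitch \<alpha> \<phi> \<and>
           (\<lambda>n::int. norm (fourier_coeff \<phi> n))
             \<in> O[int_at_infinity](\<lambda>n. ln \<bar>real_of_int n\<bar> / \<bar>real_of_int n\<bar>)"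
proof -
  obtain \<alpha> :: real where \<alpha>: "\<alpha> \<notin> \<rat>"
    using uncountable_UNIV_real countable_rat by (metis UNIV_eq_I)
  \<comment> \<open>The order of choices matters: targets first, then the times approximating them,
    then towers whose horizon depends on those times.\<close>
  obtain r c :: "nat \<Rightarrow> real" where r: "\<And>k. \<bar>r k\<bar> \<le> 4 ^ k / 6"
    and dense: "\<And>c0 r0 \<epsilon> K. \<epsilon> > 0 \<Longrightarrow> \<exists>k\<ge>K. \<bar>c k - c0\<bar> < \<epsilon> \<and> \<bar>r k - r0\<bar> < \<epsilon>"
    using dense_sequence by metis
  obtain N :: "nat \<Rightarrow> nat" where N: "\<And>k. 8 ^ k \<le> N k" "\<And>i k. i < k \<Longrightarrow> N i + 8 ^ k \<le> N k"
    and near: "\<And>k. \<exists>m::int. \<bar>1/2 + real (N k) * \<alpha> - of_int m - c k\<bar> < 1 / real (Suc k)"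
    using separated_times[OF \<alpha>, of c] by metis
  have "\<exists>E. tower \<alpha> (1 / 16 ^ k) (8 ^ k) (N k + 8 ^ Suc k) E" for k
    by (rule tower_exists[OF \<alpha>]) auto
  then have "\<exists>E. \<forall>k. tower \<alpha> (1 / 16 ^ k) (8 ^ k) (N k + 8 ^ Suc k) (E k)"
    by (intro choice allI)
  then obtain E where E: "\<And>k. tower \<alpha> (1 / 16 ^ k) (8 ^ k) (N k + 8 ^ Suc k) (E k)"
    by blast
  have ts: "tower_sequence \<alpha> N E r"
    by (rule tower_sequence.intro, rule E, rule N(1), erule N(2), rule r)
  have "\<exists>k. (\<exists>m::int. \<bar>1/2 + real (N k) * \<alpha> - of_int m - c0\<bar> < \<epsilon>) \<and> \<bar>r k - r0\<bar> < \<epsilon>"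
    if \<epsilon>: "\<epsilon> > 0" for c0 r0 \<epsilon>
  proof -
    \<comment> \<open>One half is for the distance from the orbit point to \<open>c k\<close>, the
      other for that from \<open>c k\<close> to \<open>c0\<close>.\<close>
    have \<epsilon>2: "\<epsilon> / 2 > 0" using \<epsilon> by simp
    obtain K where K: "1 / real (Suc K) < \<epsilon> / 2"
      using nat_approx_posE[OF \<epsilon>2] by blast
    obtain k where k: "k \<ge> K" "\<bar>c k - c0\<bar> < \<epsilon> / 2" "\<bar>r k - r0\<bar> < \<epsilon> / 2"
      using dense[OF \<epsilon>2] by blast
    obtain m :: int where m: "\<bar>1/2 + real (N k) * \<alpha> - of_int m - c k\<bar> < 1 / real (Suc k)"
      using near by blast
    also have "\<dots> \<le> 1 / real (Suc K)"
      using k(1) by (intro divide_left_mono) auto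
    finally have "\<bar>1/2 + real (N k) * \<alpha> - of_int m - c0\<bar> < \<epsilon>"
      using K k(2) by linarith
    with k(3) \<epsilon> show ?thesis by fastforce
  qed
  then have "besicovitch \<alpha> (tower_sequence.\<phi> \<alpha> N E r)"
    by (rule tower_sequence.besicovitch_phi[OF ts])
  with \<alpha> tower_sequence.phi_cont[OF ts] tower_sequence.fourier_phi_bigo[OF ts] show ?thesis
    by blast
qed

end
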